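(* Let $n$ be a natural number and let $P(w)=c_0+c_1w+\dots+c_nw^n$ with $c_t\in\mathbb{C}$, and let $\lambda\in\mathbb{C}$. Let $A_1=z\frac{d}{dz}$, $A_2=e^{z}\frac{d}{dz}$, $A_3=\frac1z\frac{d}{dz}$. For every two complex constants $a$ and $b$, the following equalities hold: $$P(a+bA_1)z^{\lambda}=P(a+b\lambda)z^{\lambda},$$ $$P(a+bA_2)e^{-\lambda e^{-z}}=P(a+b\lambda)e^{-\lambda e^{-z}},$$ $$P(a+bA_3)e^{\frac12\lambda z^2}=P(a+b\lambda)e^{\frac12\lambda z^2}.$$
   Context: For a linear differential operator $L$ and a polynomial $P(w)=\sum_{t=0}^n c_tw^t$, $P(L)=\sum_{t=0}^n c_tL^t$, where $L^t$ is the $t$-fold composition and $L^0$ is the identity; $a+bA$ denotes the operator $f\mapsto af+bAf$. The operators act on functions of the complex variable $z$; $z^\lambda$ denotes a holomorphic branch of the power function on a domain in $\mathbb{C}\setminus\{0\}$ on which one exists, and the third equality is understood for $z\neq0$. *)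

theory Defs
  imports "HOL-Complex_Analysis.Complex_Analysis" "HOL-Computational_Algebra.Polynomial"
begin

text \<open>
  Operators act on total functions on the complex plane. Every iterate of the operators below
  at a point of an open set depends only on the function on that open set, so
  equalities on a domain are stated pointwise on that domain.
\<close>

type_synonym operator = "(complex \<Rightarrow> complex) \<Rightarrow> (complex \<Rightarrow> complex)"

definition poly_op :: "complex poly \<Rightarrow> operator \<Rightarrow> operator" where
  "poly_op P L = (\<lambda>f z. \<Sum>t\<le>degree P. coeff P t * (L ^^ t) f z)"

definition affine_op :: "complex \<Rightarrow> complex \<Rightarrow> operator \<Rightarrow> operator" where
  "affine_op a b A = (\<lambda>f z. a * f z + b * A f z)"

definition A1 :: operator where
  "A1 = (\<lambda>f z. z * deriv f z)"

definition A2 :: operator where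
  "A2 = (\<lambda>f z. exp z * deriv f z)"

text \<open>The value at \<open>z = 0\<close> is an artefact of \<open>1 / 0 = 0\<close> and is never used.\<close>

definition A3 :: operator where
  "A3 = (\<lambda>f z. (1 / z) * deriv f z)"

text \<open>
  A branch of the multivalued function \<open>z\<close> to the power \<open>l\<close> is a holomorphic selection of one of
  the values \<open>exp (l * w)\<close> with \<open>exp w = z\<close> at each point. No branch of the
  logarithm on \<open>D\<close> is required, so that integer powers are branches on the whole punctured plane.
\<close>

definition power_branch_on :: "complex \<Rightarrow> complex set \<Rightarrow> (complex \<Rightarrow> complex) \<Rightarrow> bool" where
  "power_branch_on l D g \<longleftrightarrow>
     g holomorphic_on D \<and> (\<forall>z\<in>D. \<exists>w. exp w = z \<and> g z = exp (l * w))"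

end

theory Submission imports Defs begin

text \<open>
  In each case the given function satisfies $A f = \lambda f$ on an open set, and since $A$ is a
  local operator, $(a + bA)^t f = (a + b\lambda)^t f$ there. For an arbitrary branch $g$ of
  $z^\lambda$ the eigenvalue equation holds because, on a disc carrying a logarithm $h$, the
  continuous function $g \exp(-\lambda h)$ takes values in the countable set
  $\exp(2 \pi i \lambda \mathbb{Z})$ and is therefore constant.
\<close>

text \<open>Each application of \<open>affine_op a b A\<close> multiplies \<open>f\<close> by
  \<open>a + b * l\<close>, but only on \<open>D\<close>. The induction keeps \<open>z\<close>
  arbitrary because differentiating the hypothesis at a point requires it on a whole
  neighbourhood.\<close>

lemma affine_op_power_eigen:
  assumes D: "open D" and hol: "f holomorphic_on D"
    and A: "\<And>f z. A f z = h z * deriv f z"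
    and eigen: "\<And>z. z \<in> D \<Longrightarrow> h z * deriv f z = l * f z"
    and z: "z \<in> D"
  shows "(affine_op a b A ^^ t) f z = (a + b * l) ^ t * f z"
  using z
proof (induction t arbitrary: z)
  case 0
  then show ?case by simp
next
  case (Suc t)
  define m where "m = (a + b * l) ^ t"
  \<comment> \<open>The iterate is known only on \<open>D\<close>; as \<open>D\<close> is open, it
    agrees near \<open>z\<close> with a constant multiple of \<open>f\<close>, which determines its
    derivative at \<open>z\<close>.\<close>
  have "deriv ((affine_op a b A ^^ t) f) z = deriv (\<lambda>w. m * f w) z"
  proof (rule deriv_cong_ev)
    show "\<forall>\<^sub>F w in nhds z. (affine_op a b A ^^ t) f w = m * f w"
      using Suc D unfolding m_def eventually_nhds by blast
  qed simp
  also have "\<dots> = m * deriv f z"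
    using holomorphic_on_imp_differentiable_at[OF hol D Suc.prems] by (rule deriv_cmult)
  finally have "h z * deriv ((affine_op a b A ^^ t) f) z = m * (l * f z)"
    using eigen[OF Suc.prems] by (simp add: algebra_simps)
  then show ?case
    using Suc.IH[OF Suc.prems] by (simp add: affine_op_def A m_def algebra_simps)
qed

lemma poly_op_affine_op_eigen:
  assumes "open D" "f holomorphic_on D"
    and "\<And>f z. A f z = h z * deriv f z"
    and "\<And>z. z \<in> D \<Longrightarrow> h z * deriv f z = l * f z"
    and "z \<in> D"
  shows "poly_op P (affine_op a b A) f z = poly P (a + b * l) * f z"
  using affine_op_power_eigen[OF assms]
  by (simp add: poly_op_def poly_altdef sum_distrib_right mult.assoc)

lemma power_branch_on_deriv:
  assumes D: "open D" and D0: "D \<subseteq> - {0}" and g: "power_branch_on l D g" and z: "z \<in> D"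
  shows "z * deriv g z = l * g z"
proof -
  obtain r where r: "r > 0" "ball z r \<subseteq> D"
    using D z open_contains_ball by blast
  have hol: "g holomorphic_on ball z r"
    using g r(2) unfolding power_branch_on_def by (blast intro: holomorphic_on_subset)
  have zr: "z \<in> ball z r" using r by simp
  have ball0: "0 \<notin> ball z r" using r(2) D0 by blast
  \<comment> \<open>\<open>D\<close> may wind around 0 and carry no logarithm, but the disc is
    contractible and avoids 0, so the identity has a holomorphic logarithm there.\<close>
  obtain h where h: "h holomorphic_on ball z r" "\<And>w. w \<in> ball z r \<Longrightarrow> w = exp (h w)"
    using contractible_imp_holomorphic_log[of "\<lambda>w. w" "ball z r"] ball0
    by (metis convex_ball convex_imp_contractible holomorphic_on_ident)
  \<comment> \<open>The quotient of \<open>g\<close> by the local branch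
    \<open>exp (l * h w)\<close>.\<close>
  define q where "q = (\<lambda>w. g w * exp (- l * h w))"
  have "q ` ball z r \<subseteq> range (\<lambda>k::int. exp (l * (of_int (2 * k) * pi * \<i>)))"
  proof (rule image_subsetI)
    fix w assume w: "w \<in> ball z r"
    obtain v where v: "exp v = w" "g w = exp (l * v)"
      using g w r(2) unfolding power_branch_on_def by blast
    \<comment> \<open>Two logarithms of \<open>w\<close> differ by a multiple of 2 pi i. The integer
      \<open>k\<close> may vary with \<open>w\<close>, so this bounds the image of \<open>q\<close>
      only by a countable set.\<close>
    obtain k :: int where "v = h w + of_int (2 * k) * pi * \<i>"
      using v(1) h(2)[OF w] by (metis exp_eq)
    then have "q w = exp (l * (of_int (2 * k) * pi * \<i>))"
      by (simp add: q_def v(2) flip: exp_add) (simp add: algebra_simps)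
    then show "q w \<in> range (\<lambda>k::int. exp (l * (of_int (2 * k) * pi * \<i>)))" by blast
  qed
  then have "countable (q ` ball z r)"
    by (rule countable_subset) simp
  moreover have "continuous_on (ball z r) q"
    unfolding q_def by (intro continuous_intros holomorphic_on_imp_continuous_on hol h)
  then have "connected (q ` ball z r)"
    by (rule connected_continuous_image) simp
  \<comment> \<open>A connected set with two distinct points would be uncountable.\<close>
  ultimately obtain C where C: "q ` ball z r \<subseteq> {C}"
    using connected_uncountable by (metis (no_types, lifting) insertCI subsetI)
  have geq: "g w = C * exp (l * h w)" if "w \<in> ball z r" for w
  proof -
    have "q w = C" using that C by blast
    then show ?thesis by (simp add: q_def exp_minus field_simps)
  qed
  have dh: "(h has_field_derivative deriv h z) (at z)"
    using h(1) open_ball zr by (rule holomorphic_derivI)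
  have "((\<lambda>w. exp (h w)) has_field_derivative z * deriv h z) (at z)"
    using DERIV_fun_exp[OF dh] h(2)[OF zr] by simp
  \<comment> \<open>Near \<open>z\<close> the composite \<open>exp (h w)\<close> is \<open>w\<close>
    itself, so comparing derivatives gives h'(z) = 1/z.\<close>
  then have "((\<lambda>w. w) has_field_derivative z * deriv h z) (at z)"
    by (rule has_field_derivative_transform_within_open[OF _ open_ball zr]) (simp flip: h(2))
  then have zh: "z * deriv h z = 1"
    using DERIV_unique DERIV_ident by blast
  have "((\<lambda>w. C * exp (l * h w)) has_field_derivative C * exp (l * h z) * (l * deriv h z)) (at z)"
    by (auto intro!: derivative_eq_intros dh)
  then have "(g has_field_derivative C * exp (l * h z) * (l * deriv h z)) (at z)"
    by (rule has_field_derivative_transform_within_open[OF _ open_ball zr]) (simp add: geq)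
  then have "deriv g z = g z * (l * deriv h z)"
    unfolding geq[OF zr] by (rule DERIV_imp_deriv)
  then have "z * deriv g z = g z * l * (z * deriv h z)"
    by simp
  then show ?thesis using zh by simp
qed

theorem proposition1p1:
  fixes n :: nat and c :: "nat \<Rightarrow> complex" and P :: "complex poly" and l a b :: complex
  assumes "P = (\<Sum>t\<le>n. monom (c t) t)"
  shows "(\<forall>D g. open D \<and> connected D \<and> D \<noteq> {} \<and> D \<subseteq> - {0} \<and> power_branch_on l D g \<longrightarrow>
            (\<forall>z\<in>D. poly_op P (affine_op a b A1) g z = poly P (a + b * l) * g z)) \<and>
         (\<forall>z. poly_op P (affine_op a b A2) (\<lambda>u. exp (- l * exp (- u))) z
              = poly P (a + b * l) * exp (- l * exp (- z))) \<and>
         (\<forall>z. z \<noteq> 0 \<longrightarrow>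
            poly_op P (affine_op a b A3) (\<lambda>u. exp (1 / 2 * l * u ^ 2)) z
              = poly P (a + b * l) * exp (1 / 2 * l * z ^ 2))"
proof (intro conjI allI impI ballI)
  fix D g z
  assume *: "open D \<and> connected D \<and> D \<noteq> {} \<and> D \<subseteq> - {0} \<and> power_branch_on l D g" and "z \<in> D"
  then show "poly_op P (affine_op a b A1) g z = poly P (a + b * l) * g z"
    by (intro poly_op_affine_op_eigen[where D=D and h="\<lambda>z. z"])
      (auto simp: A1_def power_branch_on_deriv power_branch_on_def[of l D g])
next
  fix z :: complex
  have "((\<lambda>u. exp (- l * exp (- u))) has_field_derivative
      l * exp (- w) * exp (- l * exp (- w))) (at w)" for w
    by (auto intro!: derivative_eq_intros)
  then have "deriv (\<lambda>u. exp (- l * exp (- u))) w = l * exp (- w) * exp (- l * exp (- w))" for w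
    by (rule DERIV_imp_deriv)
  then have "exp w * deriv (\<lambda>u. exp (- l * exp (- u))) w = l * exp (- l * exp (- w))" for w
    by (simp add: exp_minus)
  then show "poly_op P (affine_op a b A2) (\<lambda>u. exp (- l * exp (- u))) z
      = poly P (a + b * l) * exp (- l * exp (- z))"
    \<comment> \<open>The function is entire and the eigenvalue equation holds everywhere.\<close>
    by (intro poly_op_affine_op_eigen[where D=UNIV and h=exp])
      (auto simp: A2_def intro!: holomorphic_intros)
next
  fix z :: complex
  assume "z \<noteq> 0"
  have "((\<lambda>u. exp (1 / 2 * l * u ^ 2)) has_field_derivative
      l * w * exp (1 / 2 * l * w ^ 2)) (at w)" for w
    by (auto intro!: derivative_eq_intros)
  then have "deriv (\<lambda>u. exp (1 / 2 * l * u ^ 2)) w = l * w * exp (1 / 2 * l * w ^ 2)" for w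
    by (rule DERIV_imp_deriv)
  then have "1 / w * deriv (\<lambda>u. exp (1 / 2 * l * u ^ 2)) w = l * exp (1 / 2 * l * w ^ 2)"
    if "w \<noteq> 0" for w
    using that by simp
  then show "poly_op P (affine_op a b A3) (\<lambda>u. exp (1 / 2 * l * u ^ 2)) z
      = poly P (a + b * l) * exp (1 / 2 * l * z ^ 2)"
    using \<open>z \<noteq> 0\<close>
    \<comment> \<open>The origin must be removed: with \<open>1 / 0 = 0\<close> the eigenvalue
      equation there would read 0 = \<open>l\<close>.\<close>
    by (intro poly_op_affine_op_eigen[where D="- {0}" and h="\<lambda>z. 1 / z"])
      (auto simp: A3_def intro!: holomorphic_intros)
qed

end
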